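(* Let $\sigma_0>0$ and $\alpha_0\in\mathbb{R}$ with $\alpha_0\neq0$. Let $\Omega_0=B_1\subset\mathbb{R}^3$ be the open unit ball, and let $u_0(x):=\frac{\alpha_0}{2}(-x_2,x_1,0)$. Let $(\Omega_t,u)$ be the unique smooth solution, in some time interval $(-\delta,\delta)$ with $\delta>0$, of the Cauchy problem for the free boundary system $$\begin{cases}\partial_t u+\langle u,\nabla\rangle u+\nabla p=0&\text{in }\Omega_t,\\ \operatorname{div}u=0&\text{in }\Omega_t,\\ p=\sigma_0H_{\partial\Omega_t}&\text{on }\partial\Omega_t,\\ V_t=\langle u,\nu_{\partial\Omega_t}\rangle&\text{on }\partial\Omega_t,\end{cases}$$ with initial data $(\Omega_0,u_0)$ at time $t=0$. Then $\operatorname{curl}u$ is not constant in $(-\delta,\delta)$, i.e. it is not the case that $\operatorname{curl}u$ is equal to one and the same constant vector at all points of $\Omega_t$ for all $t\in(-\delta,\delta)$.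
   Context: The unknowns are the bounded open sets $\Omega_t\subset\mathbb{R}^3$, the velocity field $u(t,\cdot):\Omega_t\to\mathbb{R}^3$ and the pressure $p(t,\cdot):\Omega_t\to\mathbb{R}$ (smooth up to the boundary). $\langle u,\nabla\rangle u=\sum_j u_j\partial_{x_j}u$. $\nu_{\partial\Omega_t}$ is the outer unit normal, $V_t$ is the normal velocity of the moving boundary $\partial\Omega_t$ in the direction $\nu_{\partial\Omega_t}$, and $H_{\partial\Omega_t}$ is the mean curvature, i.e. the tangential divergence of the outer unit normal (sum of the principal curvatures, equal to $2$ on the unit sphere of $\mathbb{R}^3$). Local existence and uniqueness of the smooth solution of the Cauchy problem is a known result (Coutand and Shkoller); the barycenter velocity $\int_{\Omega_t}u\,dx$ is conserved along solutions. *)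

theory Defs
  imports "HOL-Analysis.Analysis"
begin

text \<open>Smooth functions.  \<open>Ck_on\<close> and \<open>smooth_on\<close> are meant for open sets only.\<close>

primrec Ck_on ::
  "nat \<Rightarrow> 'a::real_normed_vector set \<Rightarrow> ('a \<Rightarrow> 'b::real_normed_vector) \<Rightarrow> bool" where
  "Ck_on 0 U f \<longleftrightarrow> continuous_on U f"
| "Ck_on (Suc k) U f \<longleftrightarrow> (\<forall>x\<in>U. f differentiable (at x)) \<and>
     (\<forall>v. Ck_on k U (\<lambda>x. frechet_derivative f (at x) v))"

definition smooth_on ::
  "'a::real_normed_vector set \<Rightarrow> ('a \<Rightarrow> 'b::real_normed_vector) \<Rightarrow> bool" where
  "smooth_on U f \<longleftrightarrow> (\<forall>k. Ck_on k U f)"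

text \<open>Smoothness on an arbitrary set: local smooth extendability.  For a space-time domain
  together with its lateral boundary this is smoothness up to the boundary.\<close>

definition smooth_extendable_on ::
  "'a::real_normed_vector set \<Rightarrow> ('a \<Rightarrow> 'b::real_normed_vector) \<Rightarrow> bool" where
  "smooth_extendable_on S f \<longleftrightarrow> (\<forall>z\<in>S. \<exists>U g. open U \<and> z \<in> U \<and> smooth_on U g \<and>
     (\<forall>w\<in>S \<inter> U. g w = f w))"


definition partial :: "'n \<Rightarrow> (real^'n \<Rightarrow> 'b::real_normed_vector) \<Rightarrow> real^'n \<Rightarrow> 'b" where
  "partial i f x = frechet_derivative f (at x) (axis i 1)"

definition gradient :: "(real^'n \<Rightarrow> real) \<Rightarrow> real^'n \<Rightarrow> real^'n" where
  "gradient f x = (\<chi> i. partial i f x)"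

definition divergence :: "(real^'n \<Rightarrow> real^'n) \<Rightarrow> real^'n \<Rightarrow> real" where
  "divergence v x = (\<Sum>i\<in>UNIV. partial i v x $ i)"

definition curl :: "(real^3 \<Rightarrow> real^3) \<Rightarrow> real^3 \<Rightarrow> real^3" where
  "curl v x = vector [partial 2 v x $ 3 - partial 3 v x $ 2,
                      partial 3 v x $ 1 - partial 1 v x $ 3,
                      partial 1 v x $ 2 - partial 2 v x $ 1]"

definition advection :: "(real^'n \<Rightarrow> real^'n) \<Rightarrow> (real^'n \<Rightarrow> real^'n) \<Rightarrow> real^'n \<Rightarrow> real^'n" where
  "advection u v x = (\<Sum>j\<in>UNIV. u x $ j *\<^sub>R partial j v x)"


text \<open>Near the boundary point \<open>x\<close> the set \<open>S\<close> is the sublevel set of a smooth function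
  \<open>\<phi>\<close> without critical points; then \<open>\<nabla>\<phi>\<close> points out of \<open>S\<close>.\<close>

definition local_defining_function ::
  "(real^'n) set \<Rightarrow> real^'n \<Rightarrow> (real^'n) set \<Rightarrow> (real^'n \<Rightarrow> real) \<Rightarrow> bool" where
  "local_defining_function S x U \<phi> \<longleftrightarrow> open U \<and> x \<in> U \<and> smooth_on U \<phi> \<and>
     (\<forall>y\<in>U. gradient \<phi> y \<noteq> 0 \<and> (y \<in> S \<longleftrightarrow> \<phi> y < 0))"

definition outer_normal :: "(real^'n) set \<Rightarrow> real^'n \<Rightarrow> real^'n" where
  "outer_normal S x = (THE \<nu>. \<exists>U \<phi>. local_defining_function S x U \<phi> \<and>
     \<nu> = gradient \<phi> x /\<^sub>R norm (gradient \<phi> x))"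

text \<open>Divergence of \<open>X\<close> along the hypersurface \<open>M\<close> with unit normal \<open>\<nu>\<close> at \<open>x\<close>: the trace of the
  derivative of \<open>X\<close> over the tangent plane \<open>\<nu>\<^sup>\<bottom>\<close>.  The derivative \<open>D\<close> within \<open>M\<close> is unique
  on that plane only; the normal contribution is subtracted, so the value does not depend
  on \<open>D\<close>.\<close>

definition tangential_divergence ::
  "(real^'n) set \<Rightarrow> real^'n \<Rightarrow> (real^'n \<Rightarrow> real^'n) \<Rightarrow> real^'n \<Rightarrow> real" where
  "tangential_divergence M \<nu> X x = (THE h. \<exists>D. (X has_derivative D) (at x within M) \<and>
     h = (\<Sum>i\<in>UNIV. D (axis i 1) $ i) - D \<nu> \<bullet> \<nu>)"

definition mean_curvature :: "(real^'n) set \<Rightarrow> real^'n \<Rightarrow> real" where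
  "mean_curvature S x =
     tangential_divergence (frontier S) (outer_normal S x) (outer_normal S) x"


text \<open>Smooth families \<open>(\<Omega>\<^sub>t)\<close>, \<open>t \<in> I\<close>, of bounded open sets with smooth boundary, for an open
  time interval \<open>I\<close>.  The compactness condition says that the closures vary upper semicontinuously
  and remain bounded locally uniformly in time, so that no piece of the domain appears
  suddenly or comes in from infinity.  The last condition is smoothness of the lateral
  boundary of the space-time domain, which moreover is nowhere tangent to a time slice.\<close>

definition smooth_moving_domain :: "real set \<Rightarrow> (real \<Rightarrow> (real^'n) set) \<Rightarrow> bool" where
  "smooth_moving_domain I \<Omega> \<longleftrightarrow>
     (\<forall>t\<in>I. open (\<Omega> t) \<and> bounded (\<Omega> t)) \<and>
     open {(t, x). t \<in> I \<and> x \<in> \<Omega> t} \<and>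
     (\<forall>K\<subseteq>I. compact K \<longrightarrow> compact {(t, x). t \<in> K \<and> x \<in> closure (\<Omega> t)}) \<and>
     (\<forall>t\<in>I. \<forall>x\<in>frontier (\<Omega> t). \<exists>U \<phi>. open U \<and> (t, x) \<in> U \<and> U \<subseteq> I \<times> UNIV \<and> smooth_on U \<phi> \<and>
        (\<forall>(s, y)\<in>U. gradient (\<lambda>z. \<phi> (s, z)) y \<noteq> 0 \<and> (y \<in> \<Omega> s \<longleftrightarrow> \<phi> (s, y) < 0)))"

text \<open>The normal component of the velocity of any curve that moves along with the boundary;
  it is the same for all such curves.\<close>

definition normal_velocity :: "(real \<Rightarrow> (real^'n) set) \<Rightarrow> real \<Rightarrow> real^'n \<Rightarrow> real" where
  "normal_velocity \<Omega> t x = (THE V. \<exists>\<gamma> w. \<gamma> t = x \<and> (\<forall>\<^sub>F s in nhds t. \<gamma> s \<in> frontier (\<Omega> s)) \<and>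
     (\<gamma> has_vector_derivative w) (at t) \<and> V = w \<bullet> outer_normal (\<Omega> t) x)"


definition smooth_free_boundary_solution ::
  "real \<Rightarrow> real set \<Rightarrow> (real \<Rightarrow> (real^3) set) \<Rightarrow> (real \<Rightarrow> real^3 \<Rightarrow> real^3) \<Rightarrow>
     (real \<Rightarrow> real^3 \<Rightarrow> real) \<Rightarrow> bool" where
  "smooth_free_boundary_solution \<sigma> I \<Omega> u p \<longleftrightarrow>
     smooth_moving_domain I \<Omega> \<and>
     smooth_extendable_on {(t, x). t \<in> I \<and> x \<in> closure (\<Omega> t)} (\<lambda>(t, x). u t x) \<and>
     smooth_extendable_on {(t, x). t \<in> I \<and> x \<in> closure (\<Omega> t)} (\<lambda>(t, x). p t x) \<and>
     (\<forall>t\<in>I. \<forall>x\<in>\<Omega> t.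
        vector_derivative (\<lambda>s. u s x) (at t) + advection (u t) (u t) x + gradient (p t) x = 0) \<and>
     (\<forall>t\<in>I. \<forall>x\<in>\<Omega> t. divergence (u t) x = 0) \<and>
     (\<forall>t\<in>I. \<forall>x\<in>frontier (\<Omega> t). p t x = \<sigma> * mean_curvature (\<Omega> t) x) \<and>
     (\<forall>t\<in>I. \<forall>x\<in>frontier (\<Omega> t). normal_velocity \<Omega> t x = u t x \<bullet> outer_normal (\<Omega> t) x)"

end

theory Submission
  imports Defs
begin

text \<open>Suppose that the vorticity were one constant vector. Its value can be read off from the initial
  data: it is \<open>\<alpha>0 e\<^sub>3\<close>. Let \<open>A\<^sub>i\<^sub>k = \<partial>\<^sub>k u\<^sub>i\<close> denote the velocity gradient. A vorticity that is constant
  in space and time cannot be stretched by the flow, and the third component of this condition,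
  together with incompressibility, says that \<open>A\<^sub>3\<^sub>3 = \<partial>\<^sub>3 u\<^sub>3\<close> vanishes in the whole space-time domain
  (\<open>vertical_stretching_zero\<close>).

  The rigid rotation at time \<open>0\<close> satisfies \<open>A\<^sub>3\<^sub>3 = 0\<close>; the contradiction comes from the first time derivative.
  Since \<open>\<partial>\<^sub>t A\<^sub>3\<^sub>3 = 0\<close> at time \<open>0\<close>, the evolution equation of the velocity gradient
  (\<open>velocity_gradient_equation\<close>) gives \<open>\<partial>\<^sub>3 \<partial>\<^sub>3 p = 0\<close> in the unit ball, i.e. the pressure is affine on each
  vertical chord. On the unit sphere the mean curvature is the constant \<open>2\<close> (\<open>mean_curvature_ball\<close>), so
  the pressure takes the same value at the two ends of every chord, and therefore
  it is constant in the ball (\<open>constant_on_ball_if_affine_along_chords\<close>). But a constant pressure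
  cannot balance the centrifugal force of the rotation: the trace of the evolution equation,
  whose time derivative term vanishes by incompressibility, and whose transport term vanishes at
  the centre of the ball, where the fluid is at rest, demands
  \<open>\<Delta> p = - tr A\<^sup>2 = \<alpha>0\<^sup>2 / 2 \<noteq> 0\<close>.

  The calculus behind this is carried out with directional derivatives of functions on space-time;
  the exchange of time and space derivatives is \<open>dirderiv_commute\<close>.\<close>

section \<open>Directional derivatives and smooth functions\<close>

definition dirderiv ::
  "'a::real_normed_vector \<Rightarrow> ('a \<Rightarrow> 'b::real_normed_vector) \<Rightarrow> 'a \<Rightarrow> 'b" where
  "dirderiv v f z = frechet_derivative f (at z) v"

lemma dirderiv_eq: "(f has_derivative D) (at z) \<Longrightarrow> dirderiv v f z = D v"
  unfolding dirderiv_def by (metis frechet_derivative_at)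

lemma has_derivative_dirderiv:
  "f differentiable (at z) \<Longrightarrow> (f has_derivative (\<lambda>v. dirderiv v f z)) (at z)"
  unfolding dirderiv_def by (simp add: frechet_derivative_works)

lemma dirderiv_cong_open:
  assumes "open U" "z \<in> U" "\<And>w. w \<in> U \<Longrightarrow> f w = g w"
  shows "dirderiv v f z = dirderiv v g z"
proof -
  have "(f has_derivative D) (at z) \<longleftrightarrow> (g has_derivative D) (at z)" for D
    using has_derivative_transform_within_open[of f D z UNIV U g]
      has_derivative_transform_within_open[of g D z UNIV U f] assms by auto
  then show ?thesis
    unfolding dirderiv_def frechet_derivative_def by simp
qed

text \<open>This form of the recursion equation replaces the original one as the unfolding rule, so that
  derivatives stay folded as \<open>dirderiv\<close>.\<close>
lemma Ck_on_Suc: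
  "Ck_on (Suc k) U f \<longleftrightarrow> (\<forall>x\<in>U. f differentiable (at x)) \<and> (\<forall>v. Ck_on k U (dirderiv v f))"
  by (simp add: dirderiv_def[abs_def])

declare Ck_on.simps(2) [simp del]

text \<open>A function has class \<open>C\<^sup>k\<close> as soon as it agrees near every point with some \<open>C\<^sup>k\<close> function,
  because directional derivatives only see the germ. This passes from the local smooth extensions
  of the velocity and the pressure to these functions themselves inside the space-time domain.\<close>
lemma Ck_on_local:
  assumes "\<And>z. z \<in> S \<Longrightarrow> \<exists>U g. open U \<and> z \<in> U \<and> Ck_on k U g \<and> (\<forall>w\<in>S \<inter> U. g w = f w)"
    and "open S"
  shows "Ck_on k S f"
  using assms(1)
proof (induction k arbitrary: f)
  case 0
  have "isCont f z" if "z \<in> S" for z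
  proof -
    from 0[OF that] obtain U g where U: "open U" "z \<in> U" "continuous_on U g"
      "\<And>w. w \<in> S \<inter> U \<Longrightarrow> g w = f w" by auto
    have "continuous_on (S \<inter> U) g"
      using U by (auto intro: continuous_on_subset)
    then have "continuous_on (S \<inter> U) f"
      using U(4) continuous_on_eq by blast
    then show ?thesis
      using U that \<open>open S\<close> by (simp add: continuous_on_eq_continuous_at open_Int)
  qed
  then show ?case by (simp add: continuous_at_imp_continuous_on)
next
  case (Suc k)
  have diff: "f differentiable (at z)" if "z \<in> S" for z
  proof -
    from Suc.prems[OF that] obtain U g where U: "open U" "z \<in> U" "Ck_on (Suc k) U g"
      "\<And>w. w \<in> S \<inter> U \<Longrightarrow> g w = f w" by auto
    then have "g differentiable (at z)" by (simp add: Ck_on_Suc)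
    then obtain D where "(g has_derivative D) (at z)" unfolding differentiable_def by blast
    then have "(f has_derivative D) (at z)"
      using has_derivative_transform_within_open[of g D z UNIV "S \<inter> U" f] U that \<open>open S\<close> by blast
    then show ?thesis unfolding differentiable_def by blast
  qed
  have "Ck_on k S (dirderiv v f)" for v
  proof (rule Suc.IH)
    fix z assume "z \<in> S"
    from Suc.prems[OF this] obtain U g where U: "open U" "z \<in> U" "Ck_on (Suc k) U g"
      "\<And>w. w \<in> S \<inter> U \<Longrightarrow> g w = f w" by auto
    have "dirderiv v g w = dirderiv v f w" if "w \<in> S \<inter> U" for w
      using dirderiv_cong_open[of "S \<inter> U" w g f v] U that \<open>open S\<close> by blast
    moreover have "Ck_on k U (dirderiv v g)" using U by (simp add: Ck_on_Suc)
    ultimately show "\<exists>U g. open U \<and> z \<in> U \<and> Ck_on k U g \<and> (\<forall>w\<in>S \<inter> U. g w = dirderiv v f w)"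
      using U by blast
  qed
  with diff show ?case by (simp add: Ck_on_Suc)
qed

lemma smooth_on_if_smooth_extendable_on:
  assumes "smooth_extendable_on S f" and "open W" and "W \<subseteq> S"
  shows "smooth_on W f"
  unfolding smooth_on_def
proof
  fix k
  show "Ck_on k W f"
  proof (rule Ck_on_local[OF _ \<open>open W\<close>])
    fix z assume "z \<in> W"
    then obtain U g where "open U" "z \<in> U" "smooth_on U g" "\<forall>w\<in>S \<inter> U. g w = f w"
      using assms unfolding smooth_extendable_on_def by blast
    then show "\<exists>U g. open U \<and> z \<in> U \<and> Ck_on k U g \<and> (\<forall>w\<in>W \<inter> U. g w = f w)"
      using \<open>W \<subseteq> S\<close> unfolding smooth_on_def by blast
  qed
qed

lemma continuous_on_if_smooth_extendable_on:
  assumes "smooth_extendable_on S f"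
  shows "continuous_on S f"
  unfolding continuous_on_eq_continuous_within
proof
  fix z assume "z \<in> S"
  then obtain U g where U: "open U" "z \<in> U" "smooth_on U g" "\<forall>w\<in>S \<inter> U. g w = f w"
    using assms unfolding smooth_extendable_on_def by blast
  then have "continuous_on U g" unfolding smooth_on_def using Ck_on.simps(1) by blast
  then have "isCont g z"
    using U by (simp add: continuous_on_eq_continuous_at)
  then have "continuous (at z within S) g"
    by (rule continuous_at_imp_continuous_at_within)
  moreover have "\<forall>\<^sub>F w in at z within S. g w = f w"
    using U unfolding eventually_at_topological by blast
  ultimately show "continuous (at z within S) f"
    using U \<open>z \<in> S\<close> by (simp add: continuous_within Lim_transform_eventually)
qed

lemma smooth_onD:
  assumes "smooth_on W f"
  shows smooth_on_differentiable: "z \<in> W \<Longrightarrow> f differentiable (at z)"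
    and smooth_on_dirderiv: "smooth_on W (dirderiv v f)"
    and smooth_on_continuous: "continuous_on W f"
proof -
  show "f differentiable (at z)" if "z \<in> W"
    using assms that Ck_on_Suc[of 0 W f] unfolding smooth_on_def by blast
  show "smooth_on W (dirderiv v f)"
    using assms Ck_on_Suc[of _ W f] unfolding smooth_on_def by blast
  show "continuous_on W f"
    using assms Ck_on.simps(1)[of W f] unfolding smooth_on_def by blast
qed

lemma dirderiv_bounded_linear:
  assumes "bounded_linear L" and "f differentiable (at z)"
  shows "dirderiv v (\<lambda>z. L (f z)) z = L (dirderiv v f z)"
  using bounded_linear.has_derivative[OF assms(1) has_derivative_dirderiv[OF assms(2)]]
  by (rule dirderiv_eq)

lemma Ck_on_bounded_linear:
  assumes "bounded_linear L" and "open W" and "Ck_on k W f"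
  shows "Ck_on k W (\<lambda>z. L (f z))"
  using assms(3)
proof (induction k arbitrary: f)
  case 0
  then show ?case using assms(1) by (simp add: bounded_linear.continuous_on)
next
  case (Suc k)
  have "(\<lambda>z. L (f z)) differentiable (at z)" if "z \<in> W" for z
    using bounded_linear.has_derivative[OF assms(1) has_derivative_dirderiv] Suc.prems that
    unfolding Ck_on_Suc differentiable_def[of "\<lambda>z. L (f z)"] by blast
  moreover have "Ck_on k W (dirderiv v (\<lambda>z. L (f z)))" for v
  proof (rule Ck_on_local[OF _ \<open>open W\<close>])
    fix z assume "z \<in> W"
    have "Ck_on k W (\<lambda>z. L (dirderiv v f z))"
      using Suc by (simp add: Ck_on_Suc)
    moreover have "L (dirderiv v f w) = dirderiv v (\<lambda>z. L (f z)) w" if "w \<in> W" for w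
      using dirderiv_bounded_linear[OF assms(1), of f w v] Suc.prems that by (simp add: Ck_on_Suc)
    ultimately show "\<exists>U g. open U \<and> z \<in> U \<and> Ck_on k U g \<and>
        (\<forall>w\<in>W \<inter> U. g w = dirderiv v (\<lambda>z. L (f z)) w)"
      using \<open>open W\<close> \<open>z \<in> W\<close> by blast
  qed
  ultimately show ?case by (simp add: Ck_on_Suc)
qed

lemma smooth_on_bounded_linear:
  "bounded_linear L \<Longrightarrow> open W \<Longrightarrow> smooth_on W f \<Longrightarrow> smooth_on W (\<lambda>z. L (f z))"
  by (simp add: smooth_on_def Ck_on_bounded_linear)

section \<open>Symmetry of second derivatives\<close>

lemma has_real_derivative_along_line:
  fixes f :: "'a::real_normed_vector \<Rightarrow> real"
  assumes "f differentiable (at (z + s *\<^sub>R v))"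
  shows "((\<lambda>s. f (z + s *\<^sub>R v)) has_real_derivative dirderiv v f (z + s *\<^sub>R v)) (at s)"
proof -
  have "((\<lambda>s. z + s *\<^sub>R v) has_derivative (\<lambda>h. h *\<^sub>R v)) (at s)"
    by (auto intro!: derivative_eq_intros)
  from has_derivative_compose[OF this has_derivative_dirderiv[OF assms]]
  have "((\<lambda>s. f (z + s *\<^sub>R v)) has_derivative (\<lambda>h. dirderiv (h *\<^sub>R v) f (z + s *\<^sub>R v))) (at s)" .
  moreover have "dirderiv (h *\<^sub>R v) f (z + s *\<^sub>R v) = dirderiv v f (z + s *\<^sub>R v) * h" for h
    using linear_frechet_derivative[OF assms] by (simp add: dirderiv_def linear_cmul)
  ultimately show ?thesis by (simp add: has_field_derivative_def)
qed

text \<open>The mean value theorem in the direction \<open>v\<close>, applied to the difference in the direction \<open>w\<close>,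
  and then once more in the direction \<open>w\<close>. The left-hand side is symmetric in \<open>v\<close> and \<open>w\<close>,
  which is what makes mixed derivatives commute.\<close>
lemma second_difference_eq_mixed_derivative:
  fixes f :: "'a::real_normed_vector \<Rightarrow> real"
  assumes W: "ball z r \<subseteq> W" and h: "h > 0" "h * (norm v + norm w) < r"
    and df: "\<And>y. y \<in> W \<Longrightarrow> f differentiable (at y)"
    and dvf: "\<And>y. y \<in> W \<Longrightarrow> dirderiv v f differentiable (at y)"
  shows "\<exists>y\<in>ball z r. f (z + h *\<^sub>R v + h *\<^sub>R w) - f (z + h *\<^sub>R v) - f (z + h *\<^sub>R w) + f z
           = h * h * dirderiv w (dirderiv v f) y"
proof -
  have near: "z + s *\<^sub>R v + t *\<^sub>R w \<in> ball z r" if "0 \<le> s" "s \<le> h" "0 \<le> t" "t \<le> h" for s t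
  proof -
    have "norm (s *\<^sub>R v + t *\<^sub>R w) \<le> s * norm v + t * norm w"
      using that norm_triangle_ineq[of "s *\<^sub>R v" "t *\<^sub>R w"] by simp
    also have "\<dots> \<le> h * norm v + h * norm w"
      using that by (intro add_mono mult_right_mono) auto
    also have "\<dots> < r" using h by (simp add: algebra_simps)
    finally have "dist (z + (s *\<^sub>R v + t *\<^sub>R w)) z < r" by (simp add: dist_norm)
    then show ?thesis by (simp only: mem_ball dist_commute[of z] add.assoc)
  qed
  let ?G = "\<lambda>s. f ((z + h *\<^sub>R w) + s *\<^sub>R v) - f (z + s *\<^sub>R v)"
  have dG: "(?G has_real_derivative
      dirderiv v f ((z + h *\<^sub>R w) + s *\<^sub>R v) - dirderiv v f (z + s *\<^sub>R v)) (at s)"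
    if "0 \<le> s" "s \<le> h" for s
    using near[of s h] near[of s 0] W that h df
    by (intro DERIV_diff has_real_derivative_along_line) (auto simp: algebra_simps subset_iff)
  obtain s where s: "0 < s" "s < h"
    and Gs: "?G h - ?G 0 = (h - 0) *
      (dirderiv v f ((z + h *\<^sub>R w) + s *\<^sub>R v) - dirderiv v f (z + s *\<^sub>R v))"
    using MVT2[OF \<open>0 < h\<close> dG] by auto
  let ?H = "\<lambda>t. dirderiv v f ((z + s *\<^sub>R v) + t *\<^sub>R w)"
  have dH: "(?H has_real_derivative dirderiv w (dirderiv v f) ((z + s *\<^sub>R v) + t *\<^sub>R w)) (at t)"
    if "0 \<le> t" "t \<le> h" for t
    using near[of s t] W that s dvf by (intro has_real_derivative_along_line) (auto simp: subset_iff)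
  obtain t where t: "0 < t" "t < h"
    and Ht: "?H h - ?H 0 = (h - 0) * dirderiv w (dirderiv v f) ((z + s *\<^sub>R v) + t *\<^sub>R w)"
    using MVT2[OF \<open>0 < h\<close> dH] by auto
  have "f (z + h *\<^sub>R v + h *\<^sub>R w) - f (z + h *\<^sub>R v) - f (z + h *\<^sub>R w) + f z
      = h * (?H h - ?H 0)"
    using Gs by (simp add: add.assoc add.left_commute add.commute[of "h *\<^sub>R v"] add.commute[of "s *\<^sub>R v"])
  also have "\<dots> = h * h * dirderiv w (dirderiv v f) (z + s *\<^sub>R v + t *\<^sub>R w)"
    using Ht by simp
  finally show ?thesis using near[of s t] s t by auto
qed

text \<open>By the previous lemma each of the two mixed derivatives takes the value of the normalized
  second difference somewhere in an arbitrarily small ball around \<open>z\<close>; both are continuous,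
  hence they coincide at \<open>z\<close>.\<close>
lemma dirderiv_commute:
  fixes f :: "'a::real_normed_vector \<Rightarrow> real"
  assumes f: "smooth_on W f" and W: "open W" "z \<in> W"
  shows "dirderiv v (dirderiv w f) z = dirderiv w (dirderiv v f) z"
proof (rule ccontr)
  let ?vw = "dirderiv v (dirderiv w f)" and ?wv = "dirderiv w (dirderiv v f)"
  assume "\<not> ?thesis"
  then have e: "\<bar>?vw z - ?wv z\<bar> / 2 > 0" (is "?e > 0") by simp
  note d = smooth_on_dirderiv[OF f]
  have "isCont ?vw z" "isCont ?wv z"
    using smooth_on_continuous[OF smooth_on_dirderiv[OF d]] W continuous_on_eq_continuous_at
    by blast+
  then obtain r1 r2 where r12: "r1 > 0" "r2 > 0"
    "\<forall>y. dist y z < r1 \<longrightarrow> dist (?vw y) (?vw z) < ?e"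
    "\<forall>y. dist y z < r2 \<longrightarrow> dist (?wv y) (?wv z) < ?e"
    using e unfolding continuous_at_eps_delta by blast
  obtain r0 where r0: "r0 > 0" "ball z r0 \<subseteq> W" using W openE by blast
  define r where "r = min r0 (min r1 r2)"
  \<comment> \<open>The summand 1 keeps the denominator positive when both directions vanish.\<close>
  define h where "h = r / (2 * (norm v + norm w + 1))"
  have "r > 0" using r0 r12 by (simp add: r_def)
  have pos: "norm v + norm w + 1 > 0" by (simp add: add_nonneg_pos)
  have h: "h > 0" "h * (norm v + norm w) < r"
  proof -
    show "h > 0" using \<open>r > 0\<close> pos by (simp add: h_def)
    have "h * (norm v + norm w) < h * (2 * (norm v + norm w + 1))"
      using \<open>h > 0\<close> pos by (intro mult_strict_left_mono) auto
    also have "\<dots> = r" using pos unfolding h_def by simp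
    finally show "h * (norm v + norm w) < r" .
  qed
  have sub: "ball z r \<subseteq> W" using r0 by (auto simp: r_def)
  note sd = second_difference_eq_mixed_derivative[OF sub \<open>h > 0\<close> _ smooth_on_differentiable[OF f]
      smooth_on_differentiable[OF d]]
  obtain y where y: "y \<in> ball z r"
    "f (z + h *\<^sub>R v + h *\<^sub>R w) - f (z + h *\<^sub>R v) - f (z + h *\<^sub>R w) + f z = h * h * ?wv y"
    using sd[of v w] h by blast
  obtain y' where y': "y' \<in> ball z r"
    "f (z + h *\<^sub>R w + h *\<^sub>R v) - f (z + h *\<^sub>R w) - f (z + h *\<^sub>R v) + f z = h * h * ?vw y'"
    using sd[of w v] h by (auto simp: add.commute)
  have "h * h * ?wv y = h * h * ?vw y'"
    unfolding y(2)[symmetric] y'(2)[symmetric]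
    by (simp add: add.assoc add.commute[of "h *\<^sub>R v"])
  then have "?wv y = ?vw y'" using \<open>h > 0\<close> by simp
  moreover have "dist (?vw y') (?vw z) < ?e" "dist (?wv y) (?wv z) < ?e"
    using r12 y(1) y'(1) by (auto simp: r_def dist_commute)
  ultimately show False by (simp add: dist_real_def abs_if split: if_splits)
qed

section \<open>Normal and mean curvature of the unit ball\<close>

lemma Ck_on_const:
  fixes U :: "'a::real_normed_vector set"
  shows "Ck_on k U (\<lambda>_. c)"
proof (induction k arbitrary: c)
  case (Suc k)
  have "dirderiv v (\<lambda>_. c) = (\<lambda>_. 0)" for v :: 'a
    by (rule ext, rule dirderiv_eq) (auto intro!: derivative_eq_intros)
  then show ?case using Suc by (simp add: Ck_on_Suc)
qed simp

lemma smooth_on_inner_self: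
  fixes U :: "'a::real_inner set"
  shows "smooth_on U (\<lambda>y. y \<bullet> y - c)"
proof -
  have lin: "Ck_on k U (\<lambda>y. 2 * (y \<bullet> v))" for k and v :: 'a
  proof (cases k)
    case 0
    then show ?thesis by (simp add: continuous_intros)
  next
    case (Suc l)
    have der: "((\<lambda>y. 2 * (y \<bullet> v)) has_derivative (\<lambda>w. 2 * (w \<bullet> v))) (at y)" for y
      by (auto intro!: derivative_eq_intros)
    then have "dirderiv w (\<lambda>y. 2 * (y \<bullet> v)) = (\<lambda>_. 2 * (w \<bullet> v))" for w
      by (intro ext dirderiv_eq)
    with der Suc show ?thesis
      by (auto simp: Ck_on_Suc Ck_on_const differentiable_def)
  qed
  have "Ck_on k U (\<lambda>y. y \<bullet> y - c)" for k
  proof (cases k)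
    case 0
    then show ?thesis by (simp add: continuous_intros)
  next
    case (Suc l)
    have der: "((\<lambda>y. y \<bullet> y - c) has_derivative (\<lambda>v. 2 * (y \<bullet> v))) (at y)" for y :: 'a
      by (auto intro!: derivative_eq_intros simp: inner_commute)
    then have "dirderiv v (\<lambda>y. y \<bullet> y - c) = (\<lambda>y. 2 * (y \<bullet> v))" for v :: 'a
      by (intro ext dirderiv_eq)
    with der Suc lin show ?thesis
      by (auto simp: Ck_on_Suc differentiable_def)
  qed
  then show ?thesis by (simp add: smooth_on_def)
qed

lemma gradient_eq:
  assumes "(f has_derivative D) (at x)"
  shows "gradient f x = (\<chi> i. D (axis i 1))"
  using assms by (simp add: gradient_def partial_def flip: frechet_derivative_at)

lemma dirderiv_eq_gradient_inner:
  fixes f :: "real^'n \<Rightarrow> real"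
  assumes "f differentiable (at x)"
  shows "dirderiv v f x = gradient f x \<bullet> v"
proof -
  have lin: "linear (frechet_derivative f (at x))"
    using assms by (rule linear_frechet_derivative)
  have "v = (\<Sum>i\<in>UNIV. v $ i *\<^sub>R axis i 1)"
    using basis_expansion[of v] by (simp add: scalar_mult_eq_scaleR)
  then have "frechet_derivative f (at x) v
      = frechet_derivative f (at x) (\<Sum>i\<in>UNIV. v $ i *\<^sub>R axis i 1)"
    by simp
  also have "\<dots> = (\<Sum>i\<in>UNIV. v $ i * frechet_derivative f (at x) (axis i 1))"
    by (simp add: linear_sum[OF lin] linear_cmul[OF lin])
  finally have "frechet_derivative f (at x) v
      = (\<Sum>i\<in>UNIV. v $ i * frechet_derivative f (at x) (axis i 1))" .
  then show ?thesis
    by (simp add: dirderiv_def gradient_def partial_def inner_vec_def mult.commute)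
qed

lemma local_defining_function_ball:
  fixes x :: "real^'n"
  assumes "norm x = 1"
  shows "local_defining_function (ball 0 1) x (ball x 1) (\<lambda>y. y \<bullet> y - 1)"
proof -
  have grad: "gradient (\<lambda>y. y \<bullet> y - 1) y = 2 *\<^sub>R y" for y :: "real^'n"
  proof -
    have "((\<lambda>y. y \<bullet> y - 1) has_derivative (\<lambda>v. 2 * (y \<bullet> v))) (at y)"
      by (auto intro!: derivative_eq_intros simp: inner_commute)
    then show ?thesis by (simp add: gradient_eq vec_eq_iff inner_axis)
  qed
  have "0 \<notin> ball x 1" using assms by (simp add: dist_norm)
  moreover have "y \<in> ball 0 1 \<longleftrightarrow> y \<bullet> y - 1 < 0" for y :: "real^'n"
    by (simp add: dist_norm norm_eq_sqrt_inner)
  ultimately show "local_defining_function (ball 0 1) x (ball x 1) (\<lambda>y. y \<bullet> y - 1)"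
    unfolding local_defining_function_def grad by (auto simp: smooth_on_inner_self)
qed

text \<open>Moving from a boundary point \<open>x\<close> in a direction \<open>v\<close> with \<open>x \<bullet> v \<ge> 0\<close> never enters the ball, so a
  local defining function cannot decrease to first order in such a direction. Hence its gradient
  is orthogonal to the tangent plane and points outward: it is a positive multiple of \<open>x\<close>.\<close>
lemma gradient_normalized_ball:
  fixes x :: "real^'n"
  assumes x: "norm x = 1" and ldf: "local_defining_function (ball 0 1) x U \<phi>"
  shows "gradient \<phi> x /\<^sub>R norm (gradient \<phi> x) = x"
proof -
  let ?g = "gradient \<phi> x"
  have U: "open U" "x \<in> U" and sm: "smooth_on U \<phi>" and g0: "?g \<noteq> 0"
    and sign: "\<And>y. y \<in> U \<Longrightarrow> y \<in> ball 0 1 \<longleftrightarrow> \<phi> y < 0"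
    using ldf unfolding local_defining_function_def by auto
  have diff: "\<phi> differentiable (at x)"
    using smooth_on_differentiable[OF sm] U by blast
  have der: "((\<lambda>h. \<phi> (x + h *\<^sub>R v)) has_real_derivative ?g \<bullet> v) (at 0)" for v
    using has_real_derivative_along_line[of \<phi> x 0 v] diff
    by (simp add: dirderiv_eq_gradient_inner)
  have near: "\<exists>d>0. \<forall>h. \<bar>h\<bar> < d \<longrightarrow> x + h *\<^sub>R v \<in> U" for v
  proof -
    obtain e where e: "e > 0" "ball x e \<subseteq> U" using U openE by blast
    have "isCont (\<lambda>h::real. x + h *\<^sub>R v) 0" by (simp add: continuous_intros)
    then obtain d where "d > 0" "\<forall>h. dist h 0 < d \<longrightarrow> dist (x + h *\<^sub>R v) (x + 0 *\<^sub>R v) < e"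
      using e(1) unfolding continuous_at_eps_delta by blast
    then show ?thesis using e(2) by (auto simp: dist_commute subset_iff)
  qed
  have xx: "x \<bullet> x = 1" using x by (simp add: norm_eq_1)
  have "\<phi> x = 0"
  proof (rule antisym)
    show "0 \<le> \<phi> x" using sign[of x] U x by (simp add: dist_norm)
    show "\<phi> x \<le> 0"
    proof (rule ccontr)
      assume "\<not> \<phi> x \<le> 0"
      have "isCont (\<lambda>h. \<phi> (x + h *\<^sub>R x)) 0" using der DERIV_isCont by blast
      then have "\<exists>d>0. \<forall>h. dist h 0 < d \<longrightarrow>
          dist (\<phi> (x + h *\<^sub>R x)) (\<phi> (x + 0 *\<^sub>R x)) < \<phi> x"
        using \<open>\<not> \<phi> x \<le> 0\<close> unfolding continuous_at_eps_delta by simp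
      then obtain d where d: "d > 0" "\<forall>h. \<bar>h\<bar> < d \<longrightarrow> \<bar>\<phi> (x + h *\<^sub>R x) - \<phi> x\<bar> < \<phi> x"
        by (auto simp: dist_real_def)
      obtain d' where d': "d' > 0" "\<forall>h. \<bar>h\<bar> < d' \<longrightarrow> x + h *\<^sub>R x \<in> U"
        using near by blast
      define h where "h = - (min 1 (min d d') / 2)"
      have h: "-1 < h" "h < 0" "\<bar>h\<bar> < d" "\<bar>h\<bar> < d'" using d d' by (auto simp: h_def min_def)
      have "x + h *\<^sub>R x = (1 + h) *\<^sub>R x" by (simp add: algebra_simps)
      then have "norm (x + h *\<^sub>R x) = 1 + h" using x h by simp
      then have "x + h *\<^sub>R x \<in> ball 0 1" using h by simp
      then have "\<phi> (x + h *\<^sub>R x) < 0" using sign d' h by blast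
      moreover have "\<bar>\<phi> (x + h *\<^sub>R x) - \<phi> x\<bar> < \<phi> x" using d h by blast
      ultimately show False by linarith
    qed
  qed
  \<comment> \<open>A step in such a direction leaves the ball, so \<open>\<phi>\<close> cannot become smaller than \<open>\<phi> x = 0\<close>.\<close>
  have outward: "0 \<le> ?g \<bullet> v" if v: "0 \<le> x \<bullet> v" for v
  proof (rule ccontr)
    assume "\<not> ?thesis"
    then have "?g \<bullet> v < 0" by simp
    from has_real_derivative_neg_dec_right[OF der this] obtain d where
      d: "d > 0" "\<And>h. 0 < h \<Longrightarrow> h < d \<Longrightarrow> \<phi> (x + h *\<^sub>R v) < \<phi> x" by auto
    obtain d' where d': "d' > 0" "\<forall>h. \<bar>h\<bar> < d' \<longrightarrow> x + h *\<^sub>R v \<in> U"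
      using near by blast
    define h where "h = min d d' / 2"
    have h: "0 < h" "h < d" "h < d'" using d d' by (auto simp: h_def min_def)
    have "(x + h *\<^sub>R v) \<bullet> (x + h *\<^sub>R v) = 1 + 2 * h * (x \<bullet> v) + h * h * (v \<bullet> v)"
      using xx by (simp add: inner_add_left inner_add_right inner_commute algebra_simps)
    also have "\<dots> \<ge> 1" using h v by simp
    finally have "norm (x + h *\<^sub>R v) \<ge> 1" by (simp add: norm_eq_sqrt_inner)
    then have "x + h *\<^sub>R v \<notin> ball 0 1" by simp
    moreover have "\<phi> (x + h *\<^sub>R v) < 0" using d h \<open>\<phi> x = 0\<close> by simp
    ultimately show False using sign d' h by simp
  qed
  \<comment> \<open>A tangent vector and its negative are both admissible directions.\<close>
  have tangent: "?g \<bullet> v = 0" if "x \<bullet> v = 0" for v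
    using outward[of v] outward[of "- v"] that by simp
  \<comment> \<open>The tangential part of the gradient is orthogonal to itself.\<close>
  let ?v = "?g - (?g \<bullet> x) *\<^sub>R x"
  have "x \<bullet> ?v = 0" using xx by (simp add: inner_diff_right inner_commute)
  then have "?v \<bullet> ?v = 0"
    using tangent[of ?v] by (simp add: inner_diff_left)
  then have g: "?g = (?g \<bullet> x) *\<^sub>R x" by simp
  have "?g \<bullet> x \<ge> 0" using outward[of x] xx by simp
  moreover have "?g \<bullet> x \<noteq> 0" using g g0 by (metis scaleR_zero_left)
  ultimately have pos: "?g \<bullet> x > 0" by simp
  have "norm ?g = ?g \<bullet> x" using g pos x by (metis abs_of_pos mult.right_neutral norm_scaleR)
  then show ?thesis using g pos
    by (metis divideR_right less_numeral_extra(3) scaleR_left_imp_eq)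
qed

lemma outer_normal_ball:
  fixes x :: "real^'n"
  assumes "norm x = 1"
  shows "outer_normal (ball 0 1) x = x"
  unfolding outer_normal_def
proof (rule the_equality)
  show "\<exists>U \<phi>. local_defining_function (ball 0 1) x U \<phi> \<and>
      x = gradient \<phi> x /\<^sub>R norm (gradient \<phi> x)"
    using local_defining_function_ball[OF assms]
      gradient_normalized_ball[OF assms local_defining_function_ball[OF assms]]
    by (intro exI[of _ "ball x 1"] exI[of _ "\<lambda>y. y \<bullet> y - 1"]) simp
next
  fix \<nu>
  assume "\<exists>U \<phi>. local_defining_function (ball 0 1) x U \<phi> \<and>
      \<nu> = gradient \<phi> x /\<^sub>R norm (gradient \<phi> x)"
  then show "\<nu> = x" using gradient_normalized_ball[OF assms] by auto
qed

text \<open>A derivative within the sphere is determined on tangent vectors only; there it is computed along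
  great circles.\<close>
lemma derivative_within_sphere_tangent:
  fixes x :: "'a::real_inner"
  assumes D: "(X has_derivative D) (at x within sphere 0 1)"
    and X: "\<And>y. y \<in> sphere 0 1 \<Longrightarrow> X y = y"
    and x: "norm x = 1" and v: "x \<bullet> v = 0"
  shows "D v = v"
proof -
  have lin: "linear D" using D by (rule has_derivative_linear)
  have unit: "D w = w" if "norm w = 1" "x \<bullet> w = 0" for w
  proof -
    \<comment> \<open>The great circle through \<open>x\<close> with velocity \<open>w\<close> stays on the sphere, where \<open>X\<close> is the identity.\<close>
    let ?\<gamma> = "\<lambda>s. cos s *\<^sub>R x + sin s *\<^sub>R w"
    have on: "?\<gamma> s \<in> sphere 0 1" for s
    proof -
      have "?\<gamma> s \<bullet> ?\<gamma> s = (cos s)\<^sup>2 + (sin s)\<^sup>2"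
        using that x by (simp add: inner_add_left inner_add_right inner_commute norm_eq_1 power2_eq_square)
      then show ?thesis by (simp add: norm_eq_sqrt_inner)
    qed
    have d\<gamma>: "(?\<gamma> has_derivative (\<lambda>h. h *\<^sub>R w)) (at 0)"
      by (auto intro!: derivative_eq_intros)
    have "(X has_derivative D) (at (?\<gamma> 0) within ?\<gamma> ` UNIV)"
      using on D by (auto intro: has_derivative_subset)
    from has_derivative_in_compose[OF d\<gamma> this]
    have "((\<lambda>s. X (?\<gamma> s)) has_derivative (\<lambda>h. D (h *\<^sub>R w))) (at 0)" by simp
    then have "(?\<gamma> has_derivative (\<lambda>h. D (h *\<^sub>R w))) (at 0)" using X on by simp
    then have "(\<lambda>h. D (h *\<^sub>R w)) = (\<lambda>h. h *\<^sub>R w)" using d\<gamma> by (rule has_derivative_unique)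
    then have "D (1 *\<^sub>R w) = 1 *\<^sub>R w" by meson
    then show ?thesis by simp
  qed
  show ?thesis
  proof (cases "v = 0")
    case True
    then show ?thesis using lin by (simp add: linear_0)
  next
    case False
    then have "D (v /\<^sub>R norm v) = v /\<^sub>R norm v" using v by (intro unit) auto
    then show ?thesis using False lin by (simp add: linear_cmul)
  qed
qed

text \<open>The outer normal field of the unit ball is the identity on the sphere, so each of its derivatives
  \<open>D\<close> within the sphere fixes the tangent vectors, i.e. \<open>D w = w + (x \<bullet> w) (D x - x)\<close>. The rank-one
  perturbation contributes \<open>(D x - x) \<bullet> x\<close> both to the trace and to \<open>D x \<bullet> x\<close>, and cancels.\<close>
lemma mean_curvature_ball:
  fixes x :: "real^'n"
  assumes x: "norm x = 1"
  shows "mean_curvature (ball 0 1) x = real CARD('n) - 1"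
proof -
  let ?N = "outer_normal (ball (0 :: real^'n) 1)"
  have N: "?N y = y" if "y \<in> sphere 0 1" for y
    using that by (simp add: outer_normal_ball)
  have xx: "x \<bullet> x = 1" using x by (simp add: norm_eq_1)
  have "tangential_divergence (sphere 0 1) x ?N x = real CARD('n) - 1"
    unfolding tangential_divergence_def
  proof (rule the_equality, goal_cases)
    case 1
    have "(?N has_derivative (\<lambda>v. v)) (at x within sphere 0 1)"
      by (rule has_derivative_transform[OF _ N has_derivative_ident]) (use x in auto)
    then show ?case using xx by (intro exI[of _ "\<lambda>v. v"]) simp
  next
    case (2 h)
    then obtain D where D: "(?N has_derivative D) (at x within sphere 0 1)"
      and h: "h = (\<Sum>i\<in>UNIV. D (axis i 1) $ i) - D x \<bullet> x" by blast
    have lin: "linear D" using D by (rule has_derivative_linear)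
    have Dw: "D w = w + (x \<bullet> w) *\<^sub>R (D x - x)" for w
    proof -
      have "D (w - (x \<bullet> w) *\<^sub>R x) = w - (x \<bullet> w) *\<^sub>R x"
        using xx by (intro derivative_within_sphere_tangent[OF D N x]) (auto simp: inner_diff_right)
      then show ?thesis using lin by (simp add: linear_diff linear_cmul algebra_simps)
    qed
    have "(\<Sum>i\<in>UNIV. D (axis i 1) $ i) = (\<Sum>i\<in>UNIV. 1 + x $ i * (D x - x) $ i)"
      by (rule sum.cong[OF refl], subst Dw) (simp add: inner_axis)
    also have "\<dots> = real CARD('n) + x \<bullet> (D x - x)"
      by (simp add: sum.distrib inner_vec_def)
    finally show ?case using h xx by (simp add: inner_diff_right inner_commute)
  qed
  then show ?thesis
    using N[of x] x by (simp add: mean_curvature_def frontier_ball)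
qed

section \<open>Functions that are affine along parallel chords\<close>

lemma constant_if_second_derivative_zero:
  fixes g g' :: "real \<Rightarrow> real"
  assumes "a < b" and cont: "continuous_on {a..b} g" and ends: "g a = g b"
    and d1: "\<And>s. a < s \<Longrightarrow> s < b \<Longrightarrow> (g has_real_derivative g' s) (at s)"
    and d2: "\<And>s. a < s \<Longrightarrow> s < b \<Longrightarrow> (g' has_real_derivative 0) (at s)"
    and s: "s \<in> {a..b}"
  shows "g s = g a"
proof -
  obtain z where z: "a < z" "z < b" "(*) (g' z) = (\<lambda>_. 0)"
    using Rolle_deriv[OF \<open>a < b\<close> ends cont, of "\<lambda>s. (*) (g' s)"] d1
    unfolding has_field_derivative_def by auto
  then have "g' z = 0" by (metis mult.right_neutral)
  have "\<exists>c. \<forall>s\<in>{a<..<b}. g' s = c"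
    using d2 by (intro has_field_derivative_zero_constant) (auto intro: has_field_derivative_at_within)
  then obtain c where c: "\<forall>s\<in>{a<..<b}. g' s = c" ..
  then have "g' s = 0" if "a < s" "s < b" for s
    using c that z(1,2) \<open>g' z = 0\<close> by (metis greaterThanLessThan_iff)
  then have "(g has_real_derivative 0) (at s)" if "a < s" "s < b" for s
    using d1 that by force
  then show ?thesis
    using DERIV_isconst2[OF \<open>a < b\<close> cont, of s] s by auto
qed

text \<open>A function whose second derivative in the direction \<open>e\<close> vanishes is affine on each chord parallel
  to \<open>e\<close>. Constant boundary values give it the same value at the two ends of the chord, and so it
  is constant there. In the application \<open>q\<close> is the initial pressure and \<open>e\<close> the rotation axis.\<close>
lemma constant_on_ball_if_affine_along_chords:
  fixes q q1 :: "'a::real_inner \<Rightarrow> real"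
  assumes e: "norm e = 1" and cont: "continuous_on (cball 0 1) q"
    and bdry: "\<And>x. x \<in> sphere 0 1 \<Longrightarrow> q x = c"
    and d1: "\<And>x s. x + s *\<^sub>R e \<in> ball 0 1 \<Longrightarrow>
       ((\<lambda>s. q (x + s *\<^sub>R e)) has_real_derivative q1 (x + s *\<^sub>R e)) (at s)"
    and d2: "\<And>x s. x + s *\<^sub>R e \<in> ball 0 1 \<Longrightarrow>
       ((\<lambda>s. q1 (x + s *\<^sub>R e)) has_real_derivative 0) (at s)"
    and x: "x \<in> ball 0 1"
  shows "q x = c"
proof -
  \<comment> \<open>The chord through \<open>x\<close> has midpoint \<open>y\<close> and half-length \<open>r\<close>.\<close>
  define y where "y = x - (x \<bullet> e) *\<^sub>R e"
  define r where "r = sqrt (1 - y \<bullet> y)"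
  have ee: "e \<bullet> e = 1" using e by (simp add: norm_eq_1)
  have ye: "y \<bullet> e = 0" using ee by (simp add: y_def inner_diff_left)
  have sq: "(y + s *\<^sub>R e) \<bullet> (y + s *\<^sub>R e) = y \<bullet> y + s\<^sup>2" for s
    using ee ye by (simp add: inner_add_left inner_add_right inner_commute power2_eq_square)
  have xy: "x = y + (x \<bullet> e) *\<^sub>R e" by (simp add: y_def)
  have "x \<bullet> x < 1" using x by (simp add: norm_eq_sqrt_inner)
  then have xe: "(x \<bullet> e)\<^sup>2 < 1 - y \<bullet> y" using sq[of "x \<bullet> e"] xy by simp
  then have "1 - y \<bullet> y > 0" by (smt (verit) zero_le_power2)
  then have r: "r > 0" "r\<^sup>2 = 1 - y \<bullet> y" by (auto simp: r_def)
  have inside: "y + s *\<^sub>R e \<in> ball 0 1" if "- r < s" "s < r" for s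
  proof -
    have "s\<^sup>2 < r\<^sup>2" using that by (intro power2_strict_mono) auto
    then show ?thesis using sq[of s] r by (simp add: norm_eq_sqrt_inner)
  qed
  have sph: "y + s *\<^sub>R e \<in> sphere 0 1" if "s\<^sup>2 = r\<^sup>2" for s
    using that sq[of s] r by (simp add: norm_eq_sqrt_inner)
  have closed: "y + s *\<^sub>R e \<in> cball 0 1" if "s \<in> {-r..r}" for s
    using inside[of s] sph[of s] that by (cases "s = r \<or> s = -r") auto
  have "\<bar>x \<bullet> e\<bar> < r"
    by (rule power2_less_imp_less) (use xe r in simp_all)
  then have "q (y + (x \<bullet> e) *\<^sub>R e) = q (y + (- r) *\<^sub>R e)"
  proof (intro constant_if_second_derivative_zero[of "- r" r "\<lambda>s. q (y + s *\<^sub>R e)"])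
    show "continuous_on {- r..r} (\<lambda>s. q (y + s *\<^sub>R e))"
      using closed by (intro continuous_on_compose2[OF cont]) (auto intro!: continuous_intros)
    show "q (y + (- r) *\<^sub>R e) = q (y + r *\<^sub>R e)"
      using sph[of r] sph[of "- r"] bdry by simp
  qed (use r inside d1 d2 in auto)
  also have "\<dots> = c" using sph[of "- r"] bdry by simp
  finally show ?thesis using xy by simp
qed

section \<open>Velocity gradients of space-time fields\<close>

text \<open>From here on functions of time and space live on \<open>real \<times> real^'n\<close>, so that time and space
  derivatives are directional derivatives of one function and commute by \<open>dirderiv_commute\<close>.\<close>
abbreviation dt :: "(real \<times> 'a::real_normed_vector \<Rightarrow> 'b::real_normed_vector) \<Rightarrow> real \<times> 'a \<Rightarrow> 'b"
  where "dt \<equiv> dirderiv (1, 0)"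

abbreviation dx :: "'n \<Rightarrow> (real \<times> (real^'n) \<Rightarrow> 'b::real_normed_vector) \<Rightarrow> real \<times> (real^'n) \<Rightarrow> 'b"
  where "dx i \<equiv> dirderiv (0, axis i 1)"

lemma partial_slice:
  fixes f :: "real \<times> (real^'n) \<Rightarrow> 'b::real_normed_vector"
  assumes "f differentiable (at (t, x))"
  shows "partial i (\<lambda>y. f (t, y)) x = dx i f (t, x)"
proof -
  have "((\<lambda>y. (t, y)) has_derivative (\<lambda>h. (0, h))) (at x)"
    by (auto intro!: derivative_eq_intros)
  from has_derivative_compose[OF this has_derivative_dirderiv[OF assms]]
  show ?thesis unfolding partial_def by (simp flip: frechet_derivative_at)
qed

lemma vector_derivative_slice:
  fixes f :: "real \<times> 'a::real_normed_vector \<Rightarrow> 'b::real_normed_vector"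
  assumes "f differentiable (at (t, x))"
  shows "vector_derivative (\<lambda>s. f (s, x)) (at t) = dt f (t, x)"
proof -
  have "((\<lambda>s. (s, x)) has_derivative (\<lambda>h. (h, 0))) (at t)"
    by (auto intro!: derivative_eq_intros)
  from has_derivative_compose[OF this has_derivative_dirderiv[OF assms]]
  have "((\<lambda>s. f (s, x)) has_derivative (\<lambda>h. dirderiv (h, 0) f (t, x))) (at t)" .
  moreover have "(\<lambda>h. dirderiv (h, 0) f (t, x)) = (\<lambda>h. h *\<^sub>R dt f (t, x))"
  proof
    show "dirderiv (h, 0) f (t, x) = h *\<^sub>R dt f (t, x)" for h
      using linear_cmul[OF linear_frechet_derivative[OF assms], of h "(1, 0)"]
      by (simp add: dirderiv_def)
  qed
  ultimately have "((\<lambda>s. f (s, x)) has_vector_derivative dt f (t, x)) (at t)"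
    unfolding has_vector_derivative_def by (rule subst[rotated])
  then show ?thesis by (rule vector_derivative_at)
qed

lemma dirderiv_eq_if_constant_difference:
  fixes f g :: "'a::real_normed_vector \<Rightarrow> real"
  assumes W: "open W" "z \<in> W" and g: "g differentiable (at z)"
    and diff: "\<And>w. w \<in> W \<Longrightarrow> f w - g w = c"
  shows "dirderiv v f z = dirderiv v g z"
proof -
  have "dirderiv v f z = dirderiv v (\<lambda>w. c + g w) z"
    using W diff by (intro dirderiv_cong_open[of W]) (auto simp: algebra_simps)
  also have "\<dots> = dirderiv v g z"
    using has_derivative_add[OF has_derivative_const[of c] has_derivative_dirderiv[OF g]]
    by (simp add: dirderiv_eq)
  finally show ?thesis .
qed

text \<open>The \<open>k\<close>-th space derivative of the momentum equation, with the derivatives commuted so that it becomes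
  an evolution equation for the velocity gradient \<open>A\<^sub>i\<^sub>k = \<partial>\<^sub>k u\<^sub>i\<close>, namely
  \<open>\<partial>\<^sub>t A\<^sub>i\<^sub>k + (A\<^sup>2)\<^sub>i\<^sub>k + \<langle>u, \<nabla>\<rangle> A\<^sub>i\<^sub>k + \<partial>\<^sub>k \<partial>\<^sub>i p = 0\<close>.\<close>
lemma velocity_gradient_equation:
  fixes F :: "'n::finite \<Rightarrow> real \<times> (real^'n) \<Rightarrow> real" and P :: "real \<times> (real^'n) \<Rightarrow> real"
  assumes W: "open W" and F: "\<And>j. smooth_on W (F j)" and P: "smooth_on W P"
    and euler: "\<And>z i. z \<in> W \<Longrightarrow>
      dt (F i) z + (\<Sum>j\<in>UNIV. F j z * dx j (F i) z) + dx i P z = 0"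
    and z: "z \<in> W"
  shows "dt (dx k (F i)) z + (\<Sum>j\<in>UNIV. dx k (F j) z * dx j (F i) z + F j z * dx j (dx k (F i)) z)
    + dx k (dx i P) z = 0"
proof -
  note D = has_derivative_dirderiv[OF smooth_on_differentiable[OF _ z]]
  have "((\<lambda>z. dt (F i) z + (\<Sum>j\<in>UNIV. F j z * dx j (F i) z) + dx i P z) has_derivative
     (\<lambda>v. dirderiv v (dt (F i)) z
       + (\<Sum>j\<in>UNIV. F j z * dirderiv v (dx j (F i)) z + dirderiv v (F j) z * dx j (F i) z)
       + dirderiv v (dx i P) z)) (at z)"
    by (intro has_derivative_add has_derivative_sum has_derivative_mult D F P smooth_on_dirderiv)
  then have "dx k (\<lambda>z. dt (F i) z + (\<Sum>j\<in>UNIV. F j z * dx j (F i) z) + dx i P z) z =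
      dx k (dt (F i)) z
       + (\<Sum>j\<in>UNIV. F j z * dx k (dx j (F i)) z + dx k (F j) z * dx j (F i) z)
       + dx k (dx i P) z"
    by (rule dirderiv_eq)
  moreover have "dx k (\<lambda>z. dt (F i) z + (\<Sum>j\<in>UNIV. F j z * dx j (F i) z) + dx i P z) z
      = dx k (\<lambda>_. 0) z"
    using euler by (intro dirderiv_cong_open[OF W z])
  moreover have "dx k (\<lambda>_. 0 :: real) z = 0"
    by (simp add: dirderiv_eq[OF has_derivative_const])
  ultimately show ?thesis
    by (simp add: dirderiv_commute[OF F W z, of "(0, axis k 1)"] add.commute)
qed

text \<open>For a constant vorticity \<open>a e\<^sub>3\<close> the antisymmetric part of the velocity gradient equation
  reduces to the symmetry of \<open>A\<^sup>2\<close>: transport and time derivative of the vorticity vanish, and the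
  Hessian of the pressure is symmetric. Comparing the entries \<open>(2,1)\<close> and \<open>(1,2)\<close>
  gives \<open>a (A\<^sub>1\<^sub>1 + A\<^sub>2\<^sub>2) = 0\<close>, where the bracket is \<open>- A\<^sub>3\<^sub>3\<close> by incompressibility. This is the third
  component of the vorticity equation \<open>\<langle>\<omega>, \<nabla>\<rangle> u = 0\<close>.\<close>
lemma vertical_stretching_zero:
  fixes F :: "3 \<Rightarrow> real \<times> (real^3) \<Rightarrow> real" and P :: "real \<times> (real^3) \<Rightarrow> real"
  assumes W: "open W" and F: "\<And>j. smooth_on W (F j)" and P: "smooth_on W P"
    and euler: "\<And>z i. z \<in> W \<Longrightarrow>
      dt (F i) z + (\<Sum>j\<in>UNIV. F j z * dx j (F i) z) + dx i P z = 0"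
    and div: "\<And>z. z \<in> W \<Longrightarrow> dx 1 (F 1) z + dx 2 (F 2) z + dx 3 (F 3) z = 0"
    and curl1: "\<And>z. z \<in> W \<Longrightarrow> dx 2 (F 3) z - dx 3 (F 2) z = 0"
    and curl2: "\<And>z. z \<in> W \<Longrightarrow> dx 3 (F 1) z - dx 1 (F 3) z = 0"
    and curl3: "\<And>z. z \<in> W \<Longrightarrow> dx 1 (F 2) z - dx 2 (F 1) z = a"
    and a: "a \<noteq> 0" and z: "z \<in> W"
  shows "dx 3 (F 3) z = 0"
proof -
  note E = velocity_gradient_equation[OF W F P euler z, unfolded sum_3]
  have vort: "dirderiv v (dx 1 (F 2)) z = dirderiv v (dx 2 (F 1)) z" for v
    by (rule dirderiv_eq_if_constant_difference[where W = W and c = a])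
      (use W z curl3 smooth_on_differentiable[OF smooth_on_dirderiv[OF F] z] in auto)
  have press: "dx 1 (dx 2 P) z = dx 2 (dx 1 P) z"
    by (rule dirderiv_commute[OF P W z])
  have "(dx 1 (F 1) z * dx 1 (F 2) z + dx 1 (F 2) z * dx 2 (F 2) z + dx 1 (F 3) z * dx 3 (F 2) z)
      = (dx 2 (F 1) z * dx 1 (F 1) z + dx 2 (F 2) z * dx 2 (F 1) z + dx 2 (F 3) z * dx 3 (F 1) z)"
    using E[of 1 2] E[of 2 1] by (simp add: vort press)
  then have "(dx 1 (F 2) z - dx 2 (F 1) z) * (dx 1 (F 1) z + dx 2 (F 2) z) = 0"
    using curl1[OF z] curl2[OF z] by (simp add: algebra_simps)
  then have "dx 1 (F 1) z + dx 2 (F 2) z = 0" using curl3[OF z] a by simp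
  then show ?thesis using div[OF z] by simp
qed

lemma rotation_field:
  fixes a :: real and u :: "real^3 \<Rightarrow> real^3"
  assumes U: "open U" "x \<in> U"
    and u: "\<And>y. y \<in> U \<Longrightarrow> u y = (a / 2) *\<^sub>R vector [- (y $ 2), y $ 1, 0]"
  shows "partial j u x = (a / 2) *\<^sub>R vector [- (axis j 1 $ 2), axis j 1 $ 1, 0]"
proof -
  let ?L = "\<lambda>y :: real^3. (a / 2) *\<^sub>R vector [- (y $ 2), y $ 1, 0] :: real^3"
  have "linear ?L"
    by (rule linearI) (simp_all add: vec_eq_iff forall_3 vector_3 algebra_simps)
  then have "(?L has_derivative ?L) (at x)"
    by (intro bounded_linear_imp_has_derivative) (simp add: linear_conv_bounded_linear)
  then have "(u has_derivative ?L) (at x)"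
    using U by (rule has_derivative_transform_within_open) (simp add: u)
  then show ?thesis by (simp add: partial_def flip: frechet_derivative_at)
qed

section \<open>The vorticity does not stay constant\<close>

theorem theorem1p5:
  fixes \<sigma>0 \<alpha>0 \<delta> :: real
    and \<Omega> :: "real \<Rightarrow> (real^3) set"
    and u :: "real \<Rightarrow> real^3 \<Rightarrow> real^3"
    and p :: "real \<Rightarrow> real^3 \<Rightarrow> real"
  assumes "\<sigma>0 > 0" and "\<alpha>0 \<noteq> 0" and "\<delta> > 0"
    and "smooth_free_boundary_solution \<sigma>0 {-\<delta><..<\<delta>} \<Omega> u p"
    and "\<Omega> 0 = ball 0 1"
    and "\<And>x. x \<in> \<Omega> 0 \<Longrightarrow> u 0 x = (\<alpha>0 / 2) *\<^sub>R vector [- (x $ 2), x $ 1, 0]"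
  shows "\<not> (\<exists>c. \<forall>t\<in>{-\<delta><..<\<delta>}. \<forall>x\<in>\<Omega> t. curl (u t) x = c)"
proof
  assume "\<exists>c. \<forall>t\<in>{-\<delta><..<\<delta>}. \<forall>x\<in>\<Omega> t. curl (u t) x = c"
  then obtain c where c: "\<And>t x. t \<in> {-\<delta><..<\<delta>} \<Longrightarrow> x \<in> \<Omega> t \<Longrightarrow> curl (u t) x = c" by blast
  \<comment> \<open>\<open>W\<close> is the open space-time domain; \<open>S\<close> adds its lateral boundary, where the pressure is prescribed.\<close>
  define W where "W = {(t, x). t \<in> {-\<delta><..<\<delta>} \<and> x \<in> \<Omega> t}"
  define S where "S = {(t, x). t \<in> {-\<delta><..<\<delta>} \<and> x \<in> closure (\<Omega> t)}"
  define v where "v = (\<lambda>(t, x). u t x)"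
  define P where "P = (\<lambda>(t, x). p t x)"
  define F where "F = (\<lambda>j z. v z $ j)"
  note sol = assms(4)[unfolded smooth_free_boundary_solution_def, folded S_def v_def P_def]
  have W: "open W"
    using sol unfolding smooth_moving_domain_def W_def by blast
  have WS: "W \<subseteq> S" unfolding W_def S_def using closure_subset by blast
  have v: "smooth_on W v" and P: "smooth_on W P"
    using sol smooth_on_if_smooth_extendable_on[OF _ W WS] by blast+
  have F: "smooth_on W (F j)" for j
    unfolding F_def by (rule smooth_on_bounded_linear[OF bounded_linear_vec_nth W v])
  have vF: "dirderiv w v z $ j = dirderiv w (F j) z" if "z \<in> W" for w z j
    unfolding F_def
    by (rule dirderiv_bounded_linear[OF bounded_linear_vec_nth smooth_on_differentiable[OF v that], symmetric])
  have partial_u: "partial i (u t) x $ j = dx i (F j) (t, x)" if "(t, x) \<in> W" for i j t x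
    using partial_slice[OF smooth_on_differentiable[OF v that]] vF[OF that]
    by (simp add: v_def)
  have dt_u: "vector_derivative (\<lambda>s. u s x) (at t) $ j = dt (F j) (t, x)" if "(t, x) \<in> W" for j t x
    using vector_derivative_slice[OF smooth_on_differentiable[OF v that]] vF[OF that]
    by (simp add: v_def)
  have partial_p: "partial i (p t) x = dx i P (t, x)" if "(t, x) \<in> W" for i t x
    using partial_slice[OF smooth_on_differentiable[OF P that]] by (simp add: P_def)
  have euler: "dt (F i) z + (\<Sum>j\<in>UNIV. F j z * dx j (F i) z) + dx i P z = 0" if "z \<in> W" for z i
  proof -
    obtain t x where z: "z = (t, x)" by (cases z)
    have "(vector_derivative (\<lambda>s. u s x) (at t) + advection (u t) (u t) x + gradient (p t) x) $ i = 0"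
      using sol that by (simp add: z W_def)
    then show ?thesis
      using that by (simp add: z dt_u partial_u partial_p advection_def gradient_def)
        (simp add: F_def v_def)
  qed
  have div: "dx 1 (F 1) z + dx 2 (F 2) z + dx 3 (F 3) z = 0" if "z \<in> W" for z
  proof -
    obtain t x where z: "z = (t, x)" by (cases z)
    have "divergence (u t) x = 0" using sol that by (simp add: z W_def)
    then show ?thesis using that by (simp add: z divergence_def sum_3 partial_u)
  qed
  have curl: "dx 2 (F 3) z - dx 3 (F 2) z = c $ 1" "dx 3 (F 1) z - dx 1 (F 3) z = c $ 2"
    "dx 1 (F 2) z - dx 2 (F 1) z = c $ 3" if "z \<in> W" for z
  proof -
    obtain t x where z: "z = (t, x)" by (cases z)
    have "curl (u t) x = c" using c that by (simp add: z W_def)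
    then have "c = vector [dx 2 (F 3) z - dx 3 (F 2) z, dx 3 (F 1) z - dx 1 (F 3) z,
        dx 1 (F 2) z - dx 2 (F 1) z]"
      using that by (simp add: z curl_def partial_u)
    then show "dx 2 (F 3) z - dx 3 (F 2) z = c $ 1" "dx 3 (F 1) z - dx 1 (F 3) z = c $ 2"
      "dx 1 (F 2) z - dx 2 (F 1) z = c $ 3"
      by (simp_all add: vector_3)
  qed
  have W0: "(0, x) \<in> W \<longleftrightarrow> x \<in> ball 0 1" for x
    using assms(3,5) by (simp add: W_def)
  have grad0: "dx j (F i) (0, x) = (\<alpha>0 / 2) * vector [- (axis j 1 $ 2), axis j 1 $ 1, 0] $ i"
    if "x \<in> ball 0 1" for x i j
    using rotation_field[OF _ that, of "u 0" \<alpha>0 j] assms(5,6) partial_u[of 0 x j i] that W0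
    by simp
  have A: "dx 1 (F 1) (0, x) = 0" "dx 1 (F 2) (0, x) = \<alpha>0 / 2" "dx 1 (F 3) (0, x) = 0"
    "dx 2 (F 1) (0, x) = - (\<alpha>0 / 2)" "dx 2 (F 2) (0, x) = 0" "dx 2 (F 3) (0, x) = 0"
    "dx 3 (F 1) (0, x) = 0" "dx 3 (F 2) (0, x) = 0" "dx 3 (F 3) (0, x) = 0"
    if "x \<in> ball 0 1" for x
    unfolding grad0[OF that] by (simp_all add: axis_def vector_3)
  have c_eq: "c $ 1 = 0" "c $ 2 = 0" "c $ 3 = \<alpha>0"
    using curl[of "(0, 0)"] W0[of 0] A[of 0] by auto
  have A33: "dx 3 (F 3) z = 0" if "z \<in> W" for z
    using vertical_stretching_zero[OF W F P euler div _ _ _ assms(2) that] curl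
    by (simp add: c_eq)
  have dA33: "dirderiv w (dx 3 (F 3)) z = 0" if "z \<in> W" for w z
    using dirderiv_cong_open[where f = "dx 3 (F 3)" and g = "\<lambda>_. 0" and v = w, OF W that A33]
    by (simp add: dirderiv_eq[OF has_derivative_const])
  \<comment> \<open>The \<open>(3,3)\<close> entry of the velocity gradient equation: the derivatives of \<open>A\<^sub>3\<^sub>3\<close> vanish, and so does
    \<open>(A\<^sup>2)\<^sub>3\<^sub>3\<close>, because the third row of the gradient of a rotation about the third axis is zero.\<close>
  have P33: "dx 3 (dx 3 P) (0, x) = 0" if "x \<in> ball 0 1" for x
  proof -
    have "(0, x) \<in> W" using that W0 by blast
    from velocity_gradient_equation[OF W F P euler this, of 3 3]
    show ?thesis using \<open>(0, x) \<in> W\<close> that by (simp add: sum_3 A dA33)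
  qed
  have P_const: "P (0, x) = \<sigma>0 * 2" if "x \<in> ball 0 1" for x
  proof (rule constant_on_ball_if_affine_along_chords[of "axis 3 1"
        "\<lambda>x. P (0, x)" _ "\<lambda>x. dx 3 P (0, x)", OF _ _ _ _ _ that])
    show "norm (axis 3 1 :: real^3) = 1" by (simp add: norm_axis_1)
    have "continuous_on S P" using sol continuous_on_if_smooth_extendable_on by blast
    then show "continuous_on (cball 0 1) (\<lambda>x. P (0, x))"
      by (rule continuous_on_compose2)
        (use assms(3,5) in \<open>auto simp: S_def intro!: continuous_intros\<close>)
    show "P (0, x) = \<sigma>0 * 2" if "x \<in> sphere 0 1" for x
    proof -
      have "p 0 x = \<sigma>0 * mean_curvature (\<Omega> 0) x"
        using sol assms(3,5) that by (simp add: frontier_ball)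
      then show ?thesis
        using mean_curvature_ball[of x] that assms(5) by (simp add: P_def)
    qed
    fix x :: "real^3" and s assume "x + s *\<^sub>R axis 3 1 \<in> ball 0 1"
    then have z: "(0, x) + s *\<^sub>R (0, axis 3 1) \<in> W"
      and b: "x + s *\<^sub>R axis 3 1 \<in> ball 0 1" using W0 by simp_all
    show "((\<lambda>s. P (0, x + s *\<^sub>R axis 3 1)) has_real_derivative dx 3 P (0, x + s *\<^sub>R axis 3 1)) (at s)"
      using has_real_derivative_along_line[OF smooth_on_differentiable[OF P z]] by simp
    show "((\<lambda>s. dx 3 P (0, x + s *\<^sub>R axis 3 1)) has_real_derivative 0) (at s)"
      using has_real_derivative_along_line[OF smooth_on_differentiable[OF smooth_on_dirderiv[OF P] z],
          of "(0, axis 3 1)"] P33[OF b] by simp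
  qed
  have z0: "(0, 0) \<in> W" and b0: "(0 :: real^3) \<in> ball 0 1" using W0[of 0] by simp_all
  \<comment> \<open>The contradiction is found at the centre of the ball, where the velocity is zero and the
    transport term of the velocity gradient equation disappears.\<close>
  have laplace: "dx i (dx i P) (0, 0) = 0" for i
  proof -
    have dP: "dx i P (0, x) = 0" if x: "x \<in> ball 0 1" for x
    proof -
      have "partial i (\<lambda>y. P (0, y)) x = 0"
        using dirderiv_cong_open[where f = "\<lambda>y. P (0, y)" and g = "\<lambda>_. \<sigma>0 * 2" and v = "axis i 1",
            OF open_ball x P_const]
        by (simp add: partial_def dirderiv_def)
      moreover have "(0, x) \<in> W" using x W0 by blast
      ultimately show ?thesis
        using partial_slice[OF smooth_on_differentiable[OF P], of 0 x i] by metis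
    qed
    have "partial i (\<lambda>y. dx i P (0, y)) 0 = 0"
      using dirderiv_cong_open[where f = "\<lambda>y. dx i P (0, y)" and g = "\<lambda>_. 0" and v = "axis i 1"
          and U = "ball 0 1" and z = 0, OF open_ball _ dP]
      by (simp add: partial_def dirderiv_def)
    then show ?thesis
      using partial_slice[OF smooth_on_differentiable[OF smooth_on_dirderiv[OF P] z0], of i "(0, axis i 1)"]
      by (rule trans[OF sym, rotated])
  qed
  note E = velocity_gradient_equation[OF W F P euler z0, unfolded sum_3]
  have trace: "dirderiv w (dx 1 (F 1)) (0, 0) + dirderiv w (dx 2 (F 2)) (0, 0)
      = 0" for w
  proof -
    have "((\<lambda>z. dx 1 (F 1) z + dx 2 (F 2) z) has_derivative
        (\<lambda>w. dirderiv w (dx 1 (F 1)) (0, 0) + dirderiv w (dx 2 (F 2)) (0, 0))) (at (0, 0))"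
      by (intro has_derivative_add has_derivative_dirderiv
          smooth_on_differentiable[OF smooth_on_dirderiv[OF F] z0])
    then have "dirderiv w (dx 1 (F 1)) (0, 0) + dirderiv w (dx 2 (F 2)) (0, 0)
        = dirderiv w (\<lambda>z. dx 1 (F 1) z + dx 2 (F 2) z) (0, 0)"
      by (rule dirderiv_eq[symmetric])
    also have "\<dots> = dirderiv w (\<lambda>_. 0) (0, 0)"
    proof (rule dirderiv_cong_open[OF W z0])
      show "dx 1 (F 1) z + dx 2 (F 2) z = 0" if "z \<in> W" for z
        using div[OF that] A33[OF that] by simp
    qed
    also have "\<dots> = 0" by (rule dirderiv_eq[OF has_derivative_const])
    finally show ?thesis .
  qed
  have "u 0 0 = 0"
    using assms(6)[of 0] assms(5) by (simp add: vec_eq_iff forall_3 vector_3)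
  then have "F j (0, 0) = 0" for j by (simp add: F_def v_def)
  then have "dt (dx 1 (F 1)) (0, 0) * 4 = \<alpha>0 * \<alpha>0" "dt (dx 2 (F 2)) (0, 0) * 4 = \<alpha>0 * \<alpha>0"
    using E[of 1 1] E[of 2 2] by (simp_all add: laplace A[OF b0])
  then have "\<alpha>0 * \<alpha>0 = 0" using trace[of "(1, 0)"] by linarith
  then show False using assms(2) by simp
qed

end
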